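(* Let $\alpha>-1$ and $a\in\mathbb R$, $a\neq0$. The weight matrix $$W(x)=e^{-x}x^{\alpha}\begin{pmatrix}x(1+a^2x)&ax\\ ax&1\end{pmatrix},\qquad x\in(0,\infty),$$ is a strong Darboux transformation of the direct sum of scalar Laguerre weights $$\widetilde W(x)=\begin{pmatrix}e^{-x}x^{\alpha+1}&0\\ 0&e^{-x}x^{\alpha}\end{pmatrix},\qquad x\in(0,\infty).$$
   Context: For a weight matrix $W$ of size $N$ on an interval $(x_0,x_1)$ put $\langle P,Q\rangle_W=\int_{x_0}^{x_1}P(x)W(x)Q(x)^*\,dx$ for $P,Q\in\operatorname{Mat}_N(\mathbb C[x])$. The monic orthogonal polynomials of $W$ are the unique $P_n\in\operatorname{Mat}_N(\mathbb C[x])$, $n\ge0$, of degree $n$ with leading coefficient $I$ and $\langle P_n,P_m\rangle_W=0$ for $n\ne m$. Differential operators $D=\sum_{i=0}^s\partial^iF_i(x)$, $\partial=d/dx$, act on the right on matrix functions: $P\cdot D=\sum_i P^{(i)}F_i$, and products satisfy $P\cdot(D_1D_2)=(P\cdot D_1)\cdot D_2$. $\operatorname{Mat}_N(\Omega[x])$ is the algebra of such operators with coefficients $F_i\in\operatorname{Mat}_N(\mathbb C[x])$. $$\mathcal D(W)=\{D\in\operatorname{Mat}_N(\Omega[x]): P_n\cdot D=\Lambda_n(D)P_n\text{ for some }\Lambda_n(D)\in\operatorname{Mat}_N(\mathbb C),\ \forall n\ge0\}.$$ The formal adjoint ${}^*$ is the involution (reversing products) extending the Hermitian conjugate on matrix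 functions and sending $\partial I$ to $-\partial I$. An operator $\mathcal V\in\operatorname{Mat}_N(\Omega[x])$ is degree-preserving if $\deg(P\cdot\mathcal V)=\deg P$ for all $P\in\operatorname{Mat}_N(\mathbb C[x])$. Strong Darboux transformation (general definition): for weight matrices $W_1,W_2$ of size $N$ on the same interval, $W_2$ is a strong Darboux transformation of $W_1$ if there is a degree-preserving differential operator $\mathcal V\in\operatorname{Mat}_N(\Omega[x])$ with nonsingular leading coefficient (i.e. the coefficient of its highest power of $\partial$ is a matrix polynomial whose determinant is not identically zero) such that $D=\mathcal V\mathcal N\in\mathcal D(W_1)$, where $\mathcal N=W_2\mathcal V^*W_1^{-1}$ (so $Q\cdot\mathcal N=\sum_j(-1)^j(QW_2F_j^* )^{(j)}W_1^{-1}$ if $\mathcal V=\sum_j\partial^jF_j$) is a differential operator satisfying $\langle P\cdot\mathcal V,Q\rangle_{W_2}=\langle P,Q\cdot\mathcal N\rangle_{W_1}$ for all $P,Q\in\operatorname{Mat}_N(\mathbb C[x])$. *)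

theory Defs
  imports
    "HOL-Analysis.Analysis"
    "HOL-Computational_Algebra.Polynomial"
    "HOL-Library.Function_Algebras"
begin

type_synonym 'n cmat = "complex^'n^'n"
type_synonym 'n pmat = "complex poly^'n^'n"
type_synonym 'n mfun = "real \<Rightarrow> complex^'n^'n"

definition conj_transpose :: "'n::finite cmat \<Rightarrow> 'n cmat" where
  "conj_transpose A = (\<chi> i j. cnj (A $ j $ i))"

definition eval_pmat :: "'n::finite pmat \<Rightarrow> 'n mfun" where
  "eval_pmat P x = map_matrix (\<lambda>p. poly p (of_real x)) P"

text \<open>The zero matrix polynomial has degree \<open>-\<infinity>\<close>, so that a degree-preserving
  operator cannot annihilate a nonzero constant.\<close>

definition degree_pmat :: "'n::finite pmat \<Rightarrow> ereal" where
  "degree_pmat P =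
     (if P = 0 then -\<infinity> else ereal (real (Max (range (\<lambda>(i, j). degree (P $ i $ j))))))"

definition coeff_pmat :: "'n::finite pmat \<Rightarrow> nat \<Rightarrow> 'n cmat" where
  "coeff_pmat P n = map_matrix (\<lambda>p. coeff p n) P"

definition nth_deriv :: "nat \<Rightarrow> 'n::finite mfun \<Rightarrow> 'n mfun" where
  "nth_deriv k F = ((\<lambda>G x. vector_derivative G (at x)) ^^ k) F"


section \<open>Weight matrices and their orthogonal polynomials\<close>

definition positive_definite :: "'n::finite cmat \<Rightarrow> bool" where
  "positive_definite A \<longleftrightarrow> conj_transpose A = A \<and>
     (\<forall>v. v \<noteq> 0 \<longrightarrow> Re (\<Sum>i\<in>UNIV. \<Sum>j\<in>UNIV. cnj (v $ i) * A $ i $ j * v $ j) > 0)"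

text \<open>The values of a weight outside the interval \<open>(x0, x1)\<close>, whose end points may be
  infinite, are irrelevant.\<close>

definition weight_matrix :: "ereal \<Rightarrow> ereal \<Rightarrow> 'n::finite mfun \<Rightarrow> bool" where
  "weight_matrix x0 x1 W \<longleftrightarrow> x0 < x1 \<and>
     (\<forall>k. \<forall>x\<in>einterval x0 x1. nth_deriv k W differentiable (at x)) \<and>
     (\<forall>x\<in>einterval x0 x1. positive_definite (W x)) \<and>
     (\<forall>n. set_integrable lborel (einterval x0 x1) (\<lambda>x. x ^ n *\<^sub>R W x))"

definition inner_W :: "ereal \<Rightarrow> ereal \<Rightarrow> 'n::finite mfun \<Rightarrow> 'n mfun \<Rightarrow> 'n mfun \<Rightarrow> 'n cmat" where
  "inner_W x0 x1 W F G = (LBINT x=x0..x1. F x ** W x ** conj_transpose (G x))"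

definition monic_orthogonal_polys ::
    "ereal \<Rightarrow> ereal \<Rightarrow> 'n::finite mfun \<Rightarrow> (nat \<Rightarrow> 'n pmat) \<Rightarrow> bool" where
  "monic_orthogonal_polys x0 x1 W P \<longleftrightarrow>
     (\<forall>n. degree_pmat (P n) = ereal (real n) \<and> coeff_pmat (P n) n = mat 1) \<and>
     (\<forall>n m. n \<noteq> m \<longrightarrow> inner_W x0 x1 W (eval_pmat (P n)) (eval_pmat (P m)) = 0)"


section \<open>Differential operators\<close>

text \<open>
  An operator \<open>D = (\<Sum>i. \<partial>^i F_i)\<close> is represented by the formal polynomial in \<open>\<partial>\<close> whose
  \<open>i\<close>-th coefficient is \<open>F_i\<close>.  Here \<^typ>\<open>'a poly\<close> only serves as the type of finitely supported
  coefficient sequences (with \<^const>\<open>degree\<close> as the order of the operator); the product of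
  operators is \<open>dop_mult\<close> below, not the multiplication of polynomials.
\<close>

type_synonym 'n pdop = "(complex poly^'n^'n) poly"
type_synonym 'n dop = "(real \<Rightarrow> complex^'n^'n) poly"

definition pdop_apply :: "'n::finite pmat \<Rightarrow> 'n pdop \<Rightarrow> 'n pmat" where
  "pdop_apply P D = (\<Sum>i\<le>degree D. map_matrix (pderiv ^^ i) P ** coeff D i)"

definition dop_apply :: "'n::finite mfun \<Rightarrow> 'n dop \<Rightarrow> 'n mfun" where
  "dop_apply F D x = (\<Sum>i\<le>degree D. nth_deriv i F x ** coeff D i x)"

definition dop_of_pdop :: "'n::finite pdop \<Rightarrow> 'n dop" where
  "dop_of_pdop D = map_poly eval_pmat D"

text \<open>Since operators act on the right, the Leibniz rule gives
  \<open>(\<partial>^i F)(\<partial>^j G) = (\<Sum>k\<le>j. (j choose k) \<partial>^(i+j-k) F^(k) G)\<close>.\<close>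

definition dop_mult :: "'n::finite dop \<Rightarrow> 'n dop \<Rightarrow> 'n dop" where
  "dop_mult D E = (\<Sum>i\<le>degree D. \<Sum>j\<le>degree E. \<Sum>k\<le>j.
     monom (\<lambda>x. real (j choose k) *\<^sub>R (nth_deriv k (coeff D i) x ** coeff E j x)) (i + j - k))"

definition mult_dop :: "'n::finite mfun \<Rightarrow> 'n dop" where
  "mult_dop F = monom F 0"

text \<open>\<open>(\<partial>^j F)^* = F^* (-\<partial>)^j\<close>\<close>

definition formal_adjoint :: "'n::finite dop \<Rightarrow> 'n dop" where
  "formal_adjoint D = (\<Sum>j\<le>degree D.
     dop_mult (mult_dop (\<lambda>x. conj_transpose (coeff D j x))) (monom (\<lambda>x. mat ((-1) ^ j)) j))"

definition dop_eq_on :: "real set \<Rightarrow> 'n::finite dop \<Rightarrow> 'n dop \<Rightarrow> bool" where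
  "dop_eq_on S D E \<longleftrightarrow> (\<forall>i. \<forall>x\<in>S. coeff D i x = coeff E i x)"

definition degree_preserving :: "'n::finite pdop \<Rightarrow> bool" where
  "degree_preserving V \<longleftrightarrow> (\<forall>P. degree_pmat (pdop_apply P V) = degree_pmat P)"

text \<open>The monic orthogonal polynomials of a weight matrix exist and are unique, so
  the quantifier over \<open>P\<close> ranges over exactly one sequence.\<close>

definition diff_op_algebra :: "ereal \<Rightarrow> ereal \<Rightarrow> 'n::finite mfun \<Rightarrow> 'n pdop set" where
  "diff_op_algebra x0 x1 W = {D. \<exists>P. monic_orthogonal_polys x0 x1 W P \<and>
     (\<forall>n. \<exists>\<Lambda> :: 'n cmat. pdop_apply (P n) D = map_matrix (\<lambda>c. [:c:]) \<Lambda> ** P n)}"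


section \<open>Strong Darboux transformations\<close>

definition darboux_conjugate :: "'n::finite mfun \<Rightarrow> 'n mfun \<Rightarrow> 'n pdop \<Rightarrow> 'n dop" where
  "darboux_conjugate W1 W2 V =
     dop_mult (dop_mult (mult_dop W2) (formal_adjoint (dop_of_pdop V)))
       (mult_dop (\<lambda>x. matrix_inv (W1 x)))"

text \<open>\<open>strong_darboux_transformation x0 x1 W1 W2\<close>: \<open>W2\<close> is a strong Darboux
  transformation of \<open>W1\<close>.\<close>

definition strong_darboux_transformation ::
    "ereal \<Rightarrow> ereal \<Rightarrow> 'n::finite mfun \<Rightarrow> 'n mfun \<Rightarrow> bool" where
  "strong_darboux_transformation x0 x1 W1 W2 \<longleftrightarrow>
     weight_matrix x0 x1 W1 \<and> weight_matrix x0 x1 W2 \<and>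
     (\<exists>V. degree_preserving V \<and> det (lead_coeff V) \<noteq> 0 \<and>
        (\<exists>D\<in>diff_op_algebra x0 x1 W1.
           dop_eq_on (einterval x0 x1) (dop_of_pdop D)
             (dop_mult (dop_of_pdop V) (darboux_conjugate W1 W2 V))) \<and>
        (\<forall>P Q. inner_W x0 x1 W2 (eval_pmat (pdop_apply P V)) (eval_pmat Q) =
               inner_W x0 x1 W1 (eval_pmat P)
                 (dop_apply (eval_pmat Q) (darboux_conjugate W1 W2 V))))"

end

theory Submission
  imports Defs
begin

text \<open>
  Let \<open>w\<close> be the weight \<open>e^(-x) x^\<alpha>\<close> and \<open>T\<close> the matrix with rows \<open>(1, a x)\<close> and \<open>(0, 1)\<close>, so that
  \<open>Wt = w diag(x, 1)\<close> and \<open>W = T Wt T^*\<close>.  For \<open>V = U T^(-1)\<close> the conjugate \<open>W V^* Wt^(-1)\<close> is \<open>T U'\<close>, where \<open>U'\<close>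
  is the adjoint of \<open>U\<close> with respect to \<open>Wt\<close>, and \<open>V (T U') = U U'\<close>.
  Take \<open>U\<close> with rows \<open>(1, - a E)\<close> and \<open>(- a \<partial>, 1)\<close>, where \<open>E = \<partial> x + \<alpha> + 1 - x\<close> and \<open>- \<partial>\<close> are the ladder
  operators between the polynomials \<open>L_n^(\<alpha>+1)\<close> and \<open>L_(n+1)^(\<alpha>)\<close>, which are adjoint to each other.  Then
  \<open>V\<close> has polynomial coefficients and preserves degrees, since the terms that raise degrees cancel, and
  \<open>U U' = diag(1 - a^2 E \<partial>, 1 - a^2 \<partial> E)\<close> is built from two Laguerre operators.
  All inner products reduce to Gamma moments, which turns integration by parts into an algebraic identity.
\<close>

section \<open>Derivatives of matrix functions\<close>

lemma has_vector_derivative_iff_tendsto: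
  "(f has_vector_derivative D) (at x) \<longleftrightarrow>
    ((\<lambda>h. (f (x + h) - f x) /\<^sub>R h) \<longlongrightarrow> D) (at 0)"
proof -
  have "(f has_vector_derivative D) (at x) \<longleftrightarrow>
      ((\<lambda>h. norm (f (x + h) - f x - h *\<^sub>R D) / norm h) \<longlongrightarrow> 0) (at 0)"
    by (simp add: has_vector_derivative_def has_derivative_at bounded_linear_scaleR_left)
  also have "\<dots> \<longleftrightarrow> ((\<lambda>h. norm ((f (x + h) - f x) /\<^sub>R h - D)) \<longlongrightarrow> 0) (at 0)"
  proof (rule Lim_cong_within[OF refl refl refl])
    fix h :: real assume "h \<noteq> 0"
    then have "(f (x + h) - f x) /\<^sub>R h - D = (f (x + h) - f x - h *\<^sub>R D) /\<^sub>R h"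
      by (simp add: scaleR_diff_right)
    then show "norm (f (x + h) - f x - h *\<^sub>R D) / norm h = norm ((f (x + h) - f x) /\<^sub>R h - D)"
      by (simp add: divide_inverse)
  qed
  also have "\<dots> \<longleftrightarrow> ((\<lambda>h. (f (x + h) - f x) /\<^sub>R h) \<longlongrightarrow> D) (at 0)"
    by (simp only: tendsto_norm_zero_iff LIM_zero_iff)
  finally show ?thesis .
qed

lemma has_vector_derivative_matrixI:
  fixes F :: "real \<Rightarrow> 'a::real_normed_vector^'m^'n"
  assumes "\<And>i j. ((\<lambda>x. F x $ i $ j) has_vector_derivative D $ i $ j) (at x)"
  shows "(F has_vector_derivative D) (at x)"
  using assms unfolding has_vector_derivative_iff_tendsto
  by (intro vec_tendstoI) simp

lemma has_vector_derivative_poly: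
  "((\<lambda>x. poly p (of_real x) :: complex) has_vector_derivative poly (pderiv p) (of_real x)) (at x)"
  by (rule has_vector_derivative_real_field, rule poly_DERIV)

lemma has_vector_derivative_eval_pmat:
  "(eval_pmat P has_vector_derivative eval_pmat (map_matrix pderiv P) x) (at x)"
  unfolding eval_pmat_def
  by (rule has_vector_derivative_matrixI) (simp add: has_vector_derivative_poly)

lemma map_matrix_comp: "map_matrix f (map_matrix g A) = map_matrix (f \<circ> g) A"
  by (simp add: vec_eq_iff)

lemma nth_deriv_0 [simp]: "nth_deriv 0 F = F"
  by (simp add: nth_deriv_def)

lemma nth_deriv_Suc: "nth_deriv (Suc k) F = (\<lambda>x. vector_derivative (nth_deriv k F) (at x))"
  by (simp add: nth_deriv_def)

lemma nth_deriv_eval_pmat: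
  "nth_deriv k (eval_pmat P) = eval_pmat (map_matrix (pderiv ^^ k) P)"
proof (induction k)
  case 0
  show ?case by (simp add: map_matrix_def)
next
  case (Suc k)
  show ?case
    by (auto simp: nth_deriv_Suc Suc.IH vector_derivative_at[OF has_vector_derivative_eval_pmat]
        map_matrix_comp o_def)
qed

lemma nth_deriv_0_fun [simp]: "nth_deriv k 0 = 0"
  by (induction k) (simp_all add: nth_deriv_Suc zero_fun_def)

lemma eval_pmat_0 [simp]: "eval_pmat 0 = 0"
  by (rule ext) (simp add: eval_pmat_def vec_eq_iff)

lemma eval_pmat_mult: "eval_pmat (P ** Q) x = eval_pmat P x ** eval_pmat Q x"
  by (simp add: eval_pmat_def vec_eq_iff matrix_matrix_mult_def poly_sum)

lemma eval_pmat_sum: "eval_pmat (sum P A) x = (\<Sum>i\<in>A. eval_pmat (P i) x)"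
  by (simp add: eval_pmat_def vec_eq_iff poly_sum)

lemma matrix_mul_rzero [simp]: "(A :: 'a::semiring_1^'n^'m) ** (0 :: 'a^'k^'n) = 0"
  by (simp add: vec_eq_iff matrix_matrix_mult_def)

lemma matrix_mul_lzero [simp]: "(0 :: 'a::semiring_1^'n^'m) ** (A :: 'a^'k^'n) = 0"
  by (simp add: vec_eq_iff matrix_matrix_mult_def)

lemma sum_fun_apply: "sum f A x = (\<Sum>i\<in>A. f i x)"
  by (induction A rule: infinite_finite_induct) auto

section \<open>Differential operators\<close>

lemma coeff_dop_of_pdop: "coeff (dop_of_pdop D) i = eval_pmat (coeff D i)"
  by (simp add: dop_of_pdop_def coeff_map_poly)

lemma pdop_apply_le:
  assumes "degree D \<le> n"
  shows "pdop_apply P D = (\<Sum>i\<le>n. map_matrix (pderiv ^^ i) P ** coeff D i)"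
  unfolding pdop_apply_def using assms
  by (intro sum.mono_neutral_left) (auto simp: not_le coeff_eq_0)

lemma dop_apply_le:
  assumes "\<And>i. i > n \<Longrightarrow> coeff D i x = 0"
  shows "dop_apply F D x = (\<Sum>i\<le>n. nth_deriv i F x ** coeff D i x)"
proof -
  have "dop_apply F D x = (\<Sum>i\<le>max n (degree D). nth_deriv i F x ** coeff D i x)"
    unfolding dop_apply_def by (intro sum.mono_neutral_left) (auto simp: not_le coeff_eq_0)
  also have "\<dots> = (\<Sum>i\<le>n. nth_deriv i F x ** coeff D i x)"
    by (intro sum.mono_neutral_right) (auto simp: not_le assms)
  finally show ?thesis .
qed

lemma dop_apply_pdop:
  assumes "dop_eq_on S E (dop_of_pdop D)" and "x \<in> S"
  shows "dop_apply (eval_pmat P) E x = eval_pmat (pdop_apply P D) x"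
proof -
  have E: "coeff E i x = eval_pmat (coeff D i) x" for i
    using assms by (simp add: dop_eq_on_def coeff_dop_of_pdop)
  have "dop_apply (eval_pmat P) E x = (\<Sum>i\<le>degree D. nth_deriv i (eval_pmat P) x ** coeff E i x)"
    by (rule dop_apply_le) (simp add: E coeff_eq_0)
  also have "\<dots> = eval_pmat (pdop_apply P D) x"
    by (simp add: E pdop_apply_def eval_pmat_sum eval_pmat_mult nth_deriv_eval_pmat)
  finally show ?thesis .
qed

lemma coeff_monom_fun: "coeff (monom f n) l x = (if n = l then f x else 0)"
  by simp

lemma coeff_dop_mult_le:
  assumes "degree D \<le> n" and "degree E \<le> m"
  shows "coeff (dop_mult D E) l x = (\<Sum>i\<le>n. \<Sum>j\<le>m. \<Sum>k\<le>j.
     if i + j - k = l then real (j choose k) *\<^sub>R (nth_deriv k (coeff D i) x ** coeff E j x) else 0)"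
    (is "_ = (\<Sum>i\<le>n. \<Sum>j\<le>m. ?s i j)")
proof -
  have z: "?s i j = 0" if "degree D < i \<or> degree E < j" for i j
  proof -
    have "nth_deriv k (coeff D i) x ** coeff E j x = 0" for k
      using that coeff_eq_0[of D i] coeff_eq_0[of E j] by auto
    then show ?thesis by (simp only: scaleR_zero_right if_cancel sum.neutral_const)
  qed
  have "coeff (dop_mult D E) l x = (\<Sum>i\<le>degree D. \<Sum>j\<le>degree E. ?s i j)"
    unfolding dop_mult_def coeff_sum sum_fun_apply coeff_monom_fun ..
  also have "\<dots> = (\<Sum>i\<le>n. \<Sum>j\<le>degree E. ?s i j)"
    using assms(1) by (intro sum.mono_neutral_left ballI sum.neutral z) auto
  also have "\<dots> = (\<Sum>i\<le>n. \<Sum>j\<le>m. ?s i j)"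
    using assms(2) by (intro sum.cong refl sum.mono_neutral_left ballI z) auto
  finally show ?thesis .
qed

lemma dop_mult_cong_right:
  assumes "dop_eq_on S E E'"
  shows "dop_eq_on S (dop_mult D E) (dop_mult D E')"
  using assms
    coeff_dop_mult_le[OF order.refl, of E "max (degree E) (degree E')" D]
    coeff_dop_mult_le[OF order.refl, of E' "max (degree E) (degree E')" D]
  by (simp add: dop_eq_on_def cong: if_cong)

section \<open>Laguerre weights\<close>

definition laguerre_weight :: "real \<Rightarrow> real \<Rightarrow> real" where
  "laguerre_weight \<alpha> x = exp (- x) * x powr \<alpha>"

definition laguerre_moment :: "real \<Rightarrow> complex poly \<Rightarrow> complex" where
  "laguerre_moment \<alpha> p = (\<Sum>k\<le>degree p. of_real (Gamma (\<alpha> + 1 + real k)) * coeff p k)"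

definition adjoint_pmat :: "'n::finite pmat \<Rightarrow> 'n pmat" where
  "adjoint_pmat P = (\<chi> i j. map_poly cnj (P $ j $ i))"

lemma einterval_0_infinity: "einterval 0 \<infinity> = {0<..}"
  by (simp add: zero_ereal_def)

lemma laguerre_weight_pos: "x > 0 \<Longrightarrow> laguerre_weight \<alpha> x > 0"
  by (simp add: laguerre_weight_def)

lemma laguerre_weight_mult_power:
  "x > 0 \<Longrightarrow> x ^ k * laguerre_weight \<alpha> x = laguerre_weight (\<alpha> + real k) x"
  by (simp add: laguerre_weight_def powr_add powr_realpow)

lemma has_real_derivative_laguerre_weight:
  assumes "x > 0"
  shows "(laguerre_weight \<alpha> has_real_derivative (\<alpha> - x) * laguerre_weight (\<alpha> - 1) x) (at x)"
  unfolding laguerre_weight_def[abs_def]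
  by (rule derivative_eq_intros refl | use assms in \<open>simp add: powr_diff field_simps\<close>)+

lemma laguerre_moment_le:
  assumes "degree p \<le> n"
  shows "laguerre_moment \<alpha> p = (\<Sum>k\<le>n. of_real (Gamma (\<alpha> + 1 + real k)) * coeff p k)"
  unfolding laguerre_moment_def using assms
  by (intro sum.mono_neutral_left) (auto simp: not_le coeff_eq_0)

lemma laguerre_moment_add:
  "laguerre_moment \<alpha> (p + q) = laguerre_moment \<alpha> p + laguerre_moment \<alpha> q"
proof -
  define n where "n = max (degree p) (degree q)"
  have "degree p \<le> n" "degree q \<le> n" "degree (p + q) \<le> n"
    by (auto simp: n_def degree_add_le_max)
  then show ?thesis
    by (simp add: laguerre_moment_le sum.distrib algebra_simps)
qed

lemma laguerre_moment_smult: "laguerre_moment \<alpha> (smult c p) = c * laguerre_moment \<alpha> p"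
  by (simp add: laguerre_moment_le[of "smult c p" "degree p"] degree_smult_le
      laguerre_moment_def sum_distrib_left mult_ac)

lemma laguerre_moment_0 [simp]: "laguerre_moment \<alpha> 0 = 0"
  by (simp add: laguerre_moment_def)

lemma laguerre_moment_shift: "laguerre_moment (\<alpha> + 1) p = laguerre_moment \<alpha> (pCons 0 p)"
  by (simp add: laguerre_moment_le[OF degree_pCons_le] laguerre_moment_def
      sum.atMost_Suc_shift add_ac del: sum.atMost_Suc)

text \<open>The integral of \<open>(x w r)'\<close> vanishes, where \<open>w\<close> is the Laguerre weight.\<close>

lemma laguerre_moment_by_parts:
  assumes "\<alpha> > -1"
  shows "laguerre_moment \<alpha> ([:0, 1:] * pderiv r + [:of_real (\<alpha> + 1), -1:] * r) = 0"
proof -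
  let ?G = "\<lambda>k. complex_of_real (Gamma (\<alpha> + 1 + real k))"
  define n where "n = degree r"
  have G: "?G (Suc k) = of_real (\<alpha> + 1 + real k) * ?G k" for k
  proof -
    have "\<alpha> + 1 + real k \<notin> \<int>\<^sub>\<le>\<^sub>0"
      using assms by (auto elim!: nonpos_Ints_cases)
    from Gamma_plus1[OF this] show ?thesis
      by (simp add: add_ac)
  qed
  let ?q = "[:0, 1:] * pderiv r + [:of_real (\<alpha> + 1), -1:] * r"
  have deg: "degree ?q \<le> Suc n"
  proof (rule degree_add_le)
    show "degree ([:0, 1:] * pderiv r) \<le> Suc n"
      using degree_mult_le[of "[:0, 1:]" "pderiv r"] by (simp add: n_def degree_pderiv)
    show "degree ([:of_real (\<alpha> + 1), -1:] * r) \<le> Suc n"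
      using degree_mult_le[of "[:of_real (\<alpha> + 1), -1 :: complex:]" r] by (simp add: n_def)
  qed
  have co: "coeff ?q k = of_real (\<alpha> + 1 + real k) * coeff r k - (if k = 0 then 0 else coeff r (k - 1))" for k
    by (cases k) (simp_all add: coeff_pderiv algebra_simps)
  have "laguerre_moment \<alpha> ?q = (\<Sum>k\<le>Suc n. ?G (Suc k) * coeff r k)
      - (\<Sum>k\<le>Suc n. ?G k * (if k = 0 then 0 else coeff r (k - 1)))"
    unfolding laguerre_moment_le[OF deg] sum_subtractf[symmetric]
    by (intro sum.cong refl) (simp only: co G, simp only: right_diff_distrib mult_ac)
  also have "(\<Sum>k\<le>Suc n. ?G (Suc k) * coeff r k) = (\<Sum>k\<le>n. ?G (Suc k) * coeff r k)"
    by (simp add: n_def coeff_eq_0)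
  also have "(\<Sum>k\<le>Suc n. ?G k * (if k = 0 then 0 else coeff r (k - 1))) = (\<Sum>k\<le>n. ?G (Suc k) * coeff r k)"
    by (simp add: sum.atMost_Suc_shift del: sum.atMost_Suc)
  finally show ?thesis by simp
qed

lemma has_bochner_integral_laguerre_weight:
  assumes "\<alpha> > -1"
  shows "has_bochner_integral lborel (\<lambda>x. indicator {0<..} x * laguerre_weight \<alpha> x) (Gamma (\<alpha> + 1))"
proof (rule has_bochner_integral_nn_integral)
  show "(\<lambda>x. indicator {0<..} x * laguerre_weight \<alpha> x) \<in> borel_measurable lborel"
    unfolding laguerre_weight_def by measurable
  show "Gamma (\<alpha> + 1) \<ge> 0" using assms Gamma_real_pos[of "\<alpha> + 1"] by simp
  have "indicator {0<..} x * laguerre_weight \<alpha> x = indicator {0..} x * x powr (\<alpha> + 1 - 1) / exp x" for x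
    by (auto simp: laguerre_weight_def indicator_def exp_minus field_simps)
  then show "(\<integral>\<^sup>+ x. ennreal (indicator {0<..} x * laguerre_weight \<alpha> x) \<partial>lborel) = ennreal (Gamma (\<alpha> + 1))"
    using Gamma_conv_nn_integral_real[of "\<alpha> + 1"] assms by simp
qed (auto simp: laguerre_weight_def)

lemma eval_pmat_eq_sum:
  assumes "\<And>i j. degree (R $ i $ j) \<le> d"
  shows "eval_pmat R x = (\<Sum>k\<le>d. x ^ k *\<^sub>R coeff_pmat R k)"
proof -
  have "poly (R $ i $ j) (of_real x) = (\<Sum>k\<le>d. coeff (R $ i $ j) k * of_real x ^ k)" for i j
    unfolding poly_altdef using assms
    by (intro sum.mono_neutral_left) (auto simp: not_le coeff_eq_0)
  then show ?thesis
    by (simp add: vec_eq_iff eval_pmat_def coeff_pmat_def scaleR_conv_of_real[where 'a = complex] mult_ac)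
qed

lemma ex_degree_bound: "\<exists>d. \<forall>i j. degree ((R :: 'n::finite pmat) $ i $ j) \<le> d"
proof -
  have "degree (R $ i $ j) \<le> Max (range (\<lambda>(i, j). degree (R $ i $ j)))" for i j
    by (rule Max_ge) (auto intro: range_eqI[where x = "(i, j)"])
  then show ?thesis by blast
qed

lemma has_bochner_integral_laguerre_pmat:
  fixes R :: "'n::finite pmat"
  assumes "\<alpha> > -1"
  shows "has_bochner_integral lborel (\<lambda>x. indicator {0<..} x *\<^sub>R laguerre_weight \<alpha> x *\<^sub>R eval_pmat R x)
    (map_matrix (laguerre_moment \<alpha>) R)"
proof -
  obtain d where d: "\<And>i j. degree (R $ i $ j) \<le> d" using ex_degree_bound[of R] by blast
  have "has_bochner_integral lborel
     (\<lambda>x. \<Sum>k\<le>d. (indicator {0<..} x * laguerre_weight (\<alpha> + real k) x) *\<^sub>R coeff_pmat R k)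
     (\<Sum>k\<le>d. Gamma (\<alpha> + real k + 1) *\<^sub>R coeff_pmat R k)"
    using assms
    by (intro has_bochner_integral_sum has_bochner_integral_scaleR_left
        has_bochner_integral_laguerre_weight) auto
  moreover have "(\<lambda>x. \<Sum>k\<le>d. (indicator {0<..} x * laguerre_weight (\<alpha> + real k) x) *\<^sub>R coeff_pmat R k)
      = (\<lambda>x. indicator {0<..} x *\<^sub>R laguerre_weight \<alpha> x *\<^sub>R eval_pmat R x)"
    by (auto simp: indicator_def fun_eq_iff eval_pmat_eq_sum[OF d] scaleR_sum_right mult.commute
        simp flip: laguerre_weight_mult_power)
  moreover have "(\<Sum>k\<le>d. Gamma (\<alpha> + real k + 1) *\<^sub>R coeff_pmat R k) = map_matrix (laguerre_moment \<alpha>) R"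
    by (simp add: vec_eq_iff coeff_pmat_def laguerre_moment_le[OF d] scaleR_conv_of_real[where 'a = complex] add_ac)
  ultimately show ?thesis by simp
qed

lemma conj_transpose_eval_pmat: "conj_transpose (eval_pmat P x) = eval_pmat (adjoint_pmat P) x"
proof -
  have "cnj (poly p (of_real x)) = poly (map_poly cnj p) (of_real x)" for p
    using poly_cnj[of p "of_real x"] by simp
  then show ?thesis
    by (simp add: conj_transpose_def eval_pmat_def adjoint_pmat_def vec_eq_iff)
qed

lemma inner_W_laguerre:
  assumes "\<alpha> > -1"
    and W: "\<And>x. x > 0 \<Longrightarrow> W x = laguerre_weight \<alpha> x *\<^sub>R eval_pmat M x"
    and F: "\<And>x. x > 0 \<Longrightarrow> F x = eval_pmat P x" and G: "\<And>x. x > 0 \<Longrightarrow> G x = eval_pmat Q x"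
  shows "inner_W 0 \<infinity> W F G = map_matrix (laguerre_moment \<alpha>) (P ** M ** adjoint_pmat Q)"
proof -
  have "inner_W 0 \<infinity> W F G
      = (LBINT x. indicator {0<..} x *\<^sub>R (F x ** W x ** conj_transpose (G x)))"
    by (simp add: inner_W_def interval_lebesgue_integral_def einterval_0_infinity
        set_lebesgue_integral_def)
  also have "\<dots> = (LBINT x. indicator {0<..} x *\<^sub>R
      laguerre_weight \<alpha> x *\<^sub>R eval_pmat (P ** M ** adjoint_pmat Q) x)"
    by (rule Bochner_Integration.integral_cong)
      (auto simp: indicator_def W F G conj_transpose_eval_pmat eval_pmat_mult
        matrix_scalar_ac simp flip: scalar_matrix_assoc)
  also have "\<dots> = map_matrix (laguerre_moment \<alpha>) (P ** M ** adjoint_pmat Q)"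
    by (rule has_bochner_integral_integral_eq has_bochner_integral_laguerre_pmat assms)+
  finally show ?thesis .
qed

lemma has_vector_derivative_laguerre_pmat:
  assumes "x > 0"
  shows "((\<lambda>x. laguerre_weight \<alpha> x *\<^sub>R eval_pmat M x) has_vector_derivative
    laguerre_weight (\<alpha> - 1) x *\<^sub>R
      eval_pmat (map_matrix (\<lambda>p. [:0, 1:] * pderiv p + [:of_real \<alpha>, -1:] * p) M) x) (at x)"
proof -
  have w: "laguerre_weight \<alpha> x = x * laguerre_weight (\<alpha> - 1) x"
    using laguerre_weight_mult_power[OF assms, of 1 "\<alpha> - 1"] by simp
  have "((\<lambda>x. laguerre_weight \<alpha> x *\<^sub>R eval_pmat M x) has_vector_derivative
     (laguerre_weight \<alpha> x *\<^sub>R eval_pmat (map_matrix pderiv M) x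
       + ((\<alpha> - x) * laguerre_weight (\<alpha> - 1) x) *\<^sub>R eval_pmat M x)) (at x)"
    by (rule has_vector_derivative_scaleR has_real_derivative_laguerre_weight assms
        has_vector_derivative_eval_pmat)+
  then show ?thesis
    unfolding w by (rule back_subst[where P = "\<lambda>D. (_ has_vector_derivative D) _"])
      (simp add: vec_eq_iff eval_pmat_def scaleR_conv_of_real[where 'a = complex] algebra_simps)
qed

lemma nth_deriv_laguerre_pmat:
  assumes W: "\<And>x. x > 0 \<Longrightarrow> W x = laguerre_weight \<alpha> x *\<^sub>R eval_pmat M x"
  shows "\<exists>R. \<forall>x>0. nth_deriv k W x = laguerre_weight (\<alpha> - real k) x *\<^sub>R eval_pmat R x"
proof (induction k)
  case 0
  show ?case using W by auto
next
  case (Suc k)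
  then obtain R where R: "\<And>x. x > 0 \<Longrightarrow>
      nth_deriv k W x = laguerre_weight (\<alpha> - real k) x *\<^sub>R eval_pmat R x"
    by blast
  have "vector_derivative (nth_deriv k W) (at x) = laguerre_weight (\<alpha> - real k - 1) x *\<^sub>R
      eval_pmat (map_matrix (\<lambda>p. [:0, 1:] * pderiv p + [:of_real (\<alpha> - real k), -1:] * p) R) x"
    if "x > 0" for x
    by (intro vector_derivative_at
        has_vector_derivative_transform_within_open[OF has_vector_derivative_laguerre_pmat[OF that]
          open_greaterThan[of 0]]) (use that R in auto)
  then show ?case
    by (auto simp: nth_deriv_Suc diff_diff_eq add.commute intro!: exI)
qed

lemma weight_matrix_laguerre:
  assumes "\<alpha> > -1"
    and W: "\<And>x. x > 0 \<Longrightarrow> W x = laguerre_weight \<alpha> x *\<^sub>R eval_pmat M x"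
    and pos: "\<And>x. x > 0 \<Longrightarrow> positive_definite (eval_pmat M x)"
  shows "weight_matrix 0 \<infinity> W"
  unfolding weight_matrix_def einterval_0_infinity
proof (intro conjI allI ballI)
  fix k and x :: real assume "x \<in> {0<..}"
  then have x: "x > 0" by simp
  obtain R where R: "\<And>x. x > 0 \<Longrightarrow>
      nth_deriv k W x = laguerre_weight (\<alpha> - real k) x *\<^sub>R eval_pmat R x"
    using nth_deriv_laguerre_pmat[where W = W, OF W] by blast
  show "nth_deriv k W differentiable at x"
    by (rule differentiableI_vector, rule has_vector_derivative_transform_within_open
        [OF has_vector_derivative_laguerre_pmat[OF x] open_greaterThan[of 0]]) (use x R in auto)
next
  fix x :: real assume "x \<in> {0<..}"
  then have x: "x > 0" by simp
  have eq: "cnj (v $ i) * W x $ i $ j * v $ j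
      = of_real (laguerre_weight \<alpha> x) * (cnj (v $ i) * eval_pmat M x $ i $ j * v $ j)" for v i j
    by (simp add: W[OF x] scaleR_conv_of_real[where 'a = complex])
  show "positive_definite (W x)"
    using pos[OF x] laguerre_weight_pos[OF x, of \<alpha>]
    unfolding positive_definite_def eq sum_distrib_left[symmetric]
    by (simp add: W[OF x] conj_transpose_def vec_eq_iff)
next
  fix n
  show "set_integrable lborel {0<..} (\<lambda>x. x ^ n *\<^sub>R W x)"
    unfolding set_integrable_def
  proof (rule Bochner_Integration.integrable_cong[THEN iffD1, OF refl])
    show "integrable lborel (\<lambda>x. indicator {0<..} x *\<^sub>R laguerre_weight (\<alpha> + real n) x *\<^sub>R eval_pmat M x)"
      using has_bochner_integral_laguerre_pmat[of "\<alpha> + real n" M] assms(1) integrable.intros by force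
  qed (auto simp: indicator_def W simp flip: laguerre_weight_mult_power)
qed simp

section \<open>Laguerre polynomials\<close>

definition laguerre_poly :: "real \<Rightarrow> nat \<Rightarrow> complex poly" where
  "laguerre_poly \<beta> n = (\<Sum>k\<le>n. monom
     (of_real ((- 1) ^ (n - k) * real (n choose k) * pochhammer (\<beta> + 1 + real k) (n - k))) k)"

lemma coeff_laguerre_poly:
  "coeff (laguerre_poly \<beta> n) k = (if k \<le> n then
     of_real ((- 1) ^ (n - k) * real (n choose k) * pochhammer (\<beta> + 1 + real k) (n - k)) else 0)"
  by (simp add: laguerre_poly_def coeff_sum if_distrib sum.delta cong: if_cong)

lemma coeff_laguerre_poly_rec:
  "of_nat (Suc k) * of_real (\<beta> + 1 + real k) * coeff (laguerre_poly \<beta> n) (Suc k)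
    = (of_nat k - of_nat n) * coeff (laguerre_poly \<beta> n) k"
proof (cases "k < n")
  case True
  then obtain m where n: "n = k + Suc m" by (metis add_Suc_right less_imp_Suc_add)
  have "Suc k * (n choose Suc k) = (n - k) * (n choose k)"
    by (simp only: binomial_absorption binomial_absorb_comp)
  then have "real (Suc k * (n choose Suc k)) = real ((n - k) * (n choose k))"
    by (rule arg_cong)
  moreover have "n - k = Suc m" by (simp add: n)
  ultimately have c: "real (Suc k) * real (n choose Suc k) = real (Suc m) * real (n choose k)"
    by (simp only: of_nat_mult)
  have "real (Suc k) * (\<beta> + 1 + real k) *
        ((- 1) ^ m * real (n choose Suc k) * pochhammer (\<beta> + 1 + real (Suc k)) m)
      = real (Suc k) * real (n choose Suc k) *
        ((- 1) ^ m * ((\<beta> + 1 + real k) * pochhammer (\<beta> + 1 + real k + 1) m))"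
    by (simp add: algebra_simps)
  also have "\<dots> = - real (Suc m) *
        ((- 1) ^ Suc m * real (n choose k) * pochhammer (\<beta> + 1 + real k) (Suc m))"
    unfolding c pochhammer_rec by (simp add: algebra_simps)
  finally have "complex_of_real (real (Suc k) * (\<beta> + 1 + real k) *
        ((- 1) ^ m * real (n choose Suc k) * pochhammer (\<beta> + 1 + real (Suc k)) m))
      = complex_of_real (- real (Suc m) *
        ((- 1) ^ Suc m * real (n choose k) * pochhammer (\<beta> + 1 + real k) (Suc m)))"
    by (rule arg_cong)
  moreover have "complex_of_nat k - of_nat n = of_real (- real (Suc m))"
    by (simp add: n)
  ultimately show ?thesis
    using True by (simp only: coeff_laguerre_poly of_real_mult of_real_of_nat_eq)
      (simp add: n)
qed (auto simp: coeff_laguerre_poly)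

lemma laguerre_poly_ode:
  "[:0, 1:] * pderiv (pderiv (laguerre_poly \<beta> n))
     + [:of_real (\<beta> + 1), -1:] * pderiv (laguerre_poly \<beta> n)
   = smult (- of_nat n) (laguerre_poly \<beta> n)"
proof (rule poly_eqI)
  fix k
  show "coeff ([:0, 1:] * pderiv (pderiv (laguerre_poly \<beta> n))
     + [:of_real (\<beta> + 1), -1:] * pderiv (laguerre_poly \<beta> n)) k
     = coeff (smult (- of_nat n) (laguerre_poly \<beta> n)) k"
    using coeff_laguerre_poly_rec[of k \<beta> n]
    by (cases k) (simp_all add: coeff_pderiv algebra_simps)
qed

lemma laguerre_poly_orthogonal:
  assumes "\<beta> > -1" and "n \<noteq> m"
  shows "laguerre_moment \<beta> (laguerre_poly \<beta> n * laguerre_poly \<beta> m) = 0"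
proof -
  let ?l = "laguerre_poly \<beta>"
  have *: "laguerre_moment \<beta> ([:0, 1:] * pderiv (?l n) * pderiv (?l m))
      = of_nat n * laguerre_moment \<beta> (?l n * ?l m)" for n m
  proof -
    have "[:0, 1:] * pderiv (pderiv (?l n) * ?l m)
        + [:of_real (\<beta> + 1), -1:] * (pderiv (?l n) * ?l m)
      = ([:0, 1:] * pderiv (pderiv (?l n)) + [:of_real (\<beta> + 1), -1:] * pderiv (?l n)) * ?l m
        + [:0, 1:] * pderiv (?l n) * pderiv (?l m)"
      unfolding pderiv_mult by algebra
    then have "[:0, 1:] * pderiv (pderiv (?l n) * ?l m)
        + [:of_real (\<beta> + 1), -1:] * (pderiv (?l n) * ?l m)
      = smult (- of_nat n) (?l n * ?l m) + [:0, 1:] * pderiv (?l n) * pderiv (?l m)"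
      unfolding laguerre_poly_ode by simp
    then show ?thesis
      using laguerre_moment_by_parts[OF assms(1), of "pderiv (?l n) * ?l m"]
      by (simp only: laguerre_moment_add laguerre_moment_smult) (simp add: add_eq_0_iff)
  qed
  have "of_nat n * laguerre_moment \<beta> (?l n * ?l m) = of_nat m * laguerre_moment \<beta> (?l n * ?l m)"
    using *[of n m] *[of m n] by (simp add: mult_ac)
  then show ?thesis using assms(2) by simp
qed

section \<open>Degrees of matrix polynomials\<close>

lemma Max_degree_le_iff:
  "Max (range (\<lambda>(i, j). degree ((P :: 'n::finite pmat) $ i $ j))) \<le> n
    \<longleftrightarrow> (\<forall>k\<ge>Suc n. coeff_pmat P k = 0)"
  by (auto simp: coeff_pmat_def vec_eq_iff Suc_le_eq intro!: degree_le)
    (meson coeff_eq_0 le_less_trans)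

lemma pmat_eq_0_iff: "P = 0 \<longleftrightarrow> (\<forall>k. coeff_pmat P k = 0)"
  by (auto simp: coeff_pmat_def vec_eq_iff poly_eq_iff)

lemma degree_pmat_cong:
  assumes "\<And>N. (\<forall>k\<ge>N. coeff_pmat P k = 0) \<longleftrightarrow> (\<forall>k\<ge>N. coeff_pmat Q k = 0)"
  shows "degree_pmat P = degree_pmat Q"
proof -
  have "P = 0 \<longleftrightarrow> Q = 0"
    using assms[of 0] by (simp add: pmat_eq_0_iff)
  moreover have "Max (range (\<lambda>(i, j). degree (P $ i $ j))) \<le> n
      \<longleftrightarrow> Max (range (\<lambda>(i, j). degree (Q $ i $ j))) \<le> n" for n
    unfolding Max_degree_le_iff by (rule assms)
  then have "Max (range (\<lambda>(i, j). degree (P $ i $ j))) = Max (range (\<lambda>(i, j). degree (Q $ i $ j)))"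
    by (meson order_antisym order_refl)
  ultimately show ?thesis by (simp add: degree_pmat_def)
qed

lemma degree_pmat_eqI:
  assumes "\<And>k. k > n \<Longrightarrow> coeff_pmat P k = 0" and "coeff_pmat P n \<noteq> 0"
  shows "degree_pmat P = ereal (real n)"
proof -
  have "Max (range (\<lambda>(i, j). degree (P $ i $ j))) \<le> n"
    unfolding Max_degree_le_iff using assms(1) by auto
  moreover have "\<not> Max (range (\<lambda>(i, j). degree (P $ i $ j))) < n"
  proof
    assume "Max (range (\<lambda>(i, j). degree (P $ i $ j))) < n"
    then have "Max (range (\<lambda>(i, j). degree (P $ i $ j))) \<le> n - 1" and "n > 0"
      by linarith+
    then show False unfolding Max_degree_le_iff using assms(2) by simp
  qed
  ultimately have "Max (range (\<lambda>(i, j). degree (P $ i $ j))) = n" by linarith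
  moreover have "P \<noteq> 0" using assms(2) by (auto simp: pmat_eq_0_iff)
  ultimately show ?thesis by (simp add: degree_pmat_def)
qed

section \<open>First-order operators\<close>

lemma coeff_dop_mult_first_order:
  assumes "degree D \<le> 1" and "degree E \<le> 1"
  shows "coeff (dop_mult D E) 0 x = coeff D 0 x ** coeff E 0 x + nth_deriv 1 (coeff D 0) x ** coeff E 1 x"
    and "coeff (dop_mult D E) 1 x = coeff D 0 x ** coeff E 1 x + coeff D 1 x ** coeff E 0 x
           + nth_deriv 1 (coeff D 1) x ** coeff E 1 x"
    and "coeff (dop_mult D E) 2 x = coeff D 1 x ** coeff E 1 x"
    and "l > 2 \<Longrightarrow> coeff (dop_mult D E) l x = 0"
  unfolding coeff_dop_mult_le[OF assms]
  by (simp_all add: add_ac)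

lemma degree_mult_dop: "degree (mult_dop F) = 0"
  using degree_monom_le[of F 0] by (simp add: mult_dop_def)

lemma coeff_mult_dop: "coeff (mult_dop F) i = (if i = 0 then F else 0)"
  by (simp add: mult_dop_def)

lemma coeff_mult_dop_left:
  assumes "degree E \<le> 1"
  shows "coeff (dop_mult (mult_dop F) E) 0 x = F x ** coeff E 0 x + nth_deriv 1 F x ** coeff E 1 x"
    and "coeff (dop_mult (mult_dop F) E) 1 x = F x ** coeff E 1 x"
    and "degree (dop_mult (mult_dop F) E) \<le> 1"
proof -
  have d: "degree (mult_dop F) \<le> 1" by (simp add: degree_mult_dop)
  note c = coeff_dop_mult_first_order[OF d assms, unfolded coeff_mult_dop]
  show "coeff (dop_mult (mult_dop F) E) 0 x = F x ** coeff E 0 x + nth_deriv 1 F x ** coeff E 1 x"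
    and "coeff (dop_mult (mult_dop F) E) 1 x = F x ** coeff E 1 x"
    using c(1,2)[of x] by simp_all
  have "coeff (dop_mult (mult_dop F) E) l = 0" if "l > 1" for l
  proof
    fix x
    show "coeff (dop_mult (mult_dop F) E) l x = 0 x"
      using c(3,4)[where x = x] that by (cases "l = 2") auto
  qed
  then show "degree (dop_mult (mult_dop F) E) \<le> 1" by (intro degree_le) auto
qed

lemma matrix_mul_uminus_mat_1: "(A :: 'a::ring_1^'n::finite^'m) ** mat (- 1) = - A"
  by (simp add: vec_eq_iff matrix_matrix_mult_def mat_def if_distrib cong: if_cong)

lemma coeff_formal_adjoint_first_order:
  assumes "degree D = 1"
  defines "A \<equiv> \<lambda>j x. conj_transpose (coeff D j x)"
  shows "coeff (formal_adjoint D) 0 x = A 0 x - nth_deriv 1 (A 1) x"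
    and "coeff (formal_adjoint D) 1 x = - A 1 x"
    and "degree (formal_adjoint D) \<le> 1"
proof -
  have adj: "formal_adjoint D = dop_mult (mult_dop (A 0)) (monom (\<lambda>x. mat 1) 0)
      + dop_mult (mult_dop (A 1)) (monom (\<lambda>x. mat (- 1)) 1)"
    by (simp add: formal_adjoint_def assms(1) A_def)
  have d: "degree (monom (\<lambda>x. mat 1 :: complex^'a^'a) 0 :: 'a dop) \<le> 1"
    "degree (monom (\<lambda>x. mat (- 1) :: complex^'a^'a) 1 :: 'a dop) \<le> 1"
    using degree_monom_le by (auto intro: order_trans)
  show "coeff (formal_adjoint D) 0 x = A 0 x - nth_deriv 1 (A 1) x"
    and "coeff (formal_adjoint D) 1 x = - A 1 x"
    using coeff_mult_dop_left(1,2)[OF d(1), of "A 0" x] coeff_mult_dop_left(1,2)[OF d(2), of "A 1" x]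
    by (simp_all add: adj matrix_mul_uminus_mat_1)
  show "degree (formal_adjoint D) \<le> 1"
    unfolding adj by (intro degree_add_le coeff_mult_dop_left(3) d)
qed

section \<open>Matrices of size two\<close>

definition mat2 :: "'a::zero \<Rightarrow> 'a \<Rightarrow> 'a \<Rightarrow> 'a \<Rightarrow> 'a^2^2" where
  "mat2 a b c d = vector [vector [a, b], vector [c, d]]"

lemma mat2_nth [simp]:
  "mat2 a b c d $ 1 $ 1 = a" "mat2 a b c d $ 1 $ 2 = b"
  "mat2 a b c d $ 2 $ 1 = c" "mat2 a b c d $ 2 $ 2 = d"
  by (simp_all add: mat2_def)

lemma mat2_eq_iff:
  "(A :: 'a^2^2) = B \<longleftrightarrow> A $ 1 $ 1 = B $ 1 $ 1 \<and> A $ 1 $ 2 = B $ 1 $ 2 \<and>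
     A $ 2 $ 1 = B $ 2 $ 1 \<and> A $ 2 $ 2 = B $ 2 $ 2"
  by (auto simp: vec_eq_iff forall_2)

lemma matrix_mult_nth_2:
  "((A :: 'a::semiring_1^2^2) ** B) $ i $ j = A $ i $ 1 * B $ 1 $ j + A $ i $ 2 * B $ 2 $ j"
  by (simp add: matrix_matrix_mult_def sum_2)

lemma eval_pmat_nth: "eval_pmat P x $ i $ j = poly (P $ i $ j) (of_real x)"
  by (simp add: eval_pmat_def)

lemma matrix_inv_right:
  assumes "A ** B = mat 1" and "B ** A = mat 1"
  shows "A ** matrix_inv A = mat 1"
  using someI[of "\<lambda>B. A ** B = mat 1 \<and> B ** A = mat 1" B] assms
  by (simp add: matrix_inv_def)

lemma map_poly_cnj_add: "map_poly cnj (p + q) = map_poly cnj p + map_poly cnj q"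
  by (rule poly_eqI) (simp add: coeff_map_poly)

lemma map_poly_cnj_mult: "map_poly cnj (p * q) = map_poly cnj p * map_poly cnj q"
  by (rule poly_eqI) (simp add: coeff_map_poly coeff_mult)

lemma map_poly_cnj_pderiv: "map_poly cnj (pderiv p) = pderiv (map_poly cnj p)"
  by (rule poly_eqI) (simp add: coeff_map_poly coeff_pderiv)

section \<open>The two weights and the intertwining operator\<close>

definition weight_pmat :: "real \<Rightarrow> 2 pmat" where
  "weight_pmat a = mat2 [:0, 1, of_real (a\<^sup>2):] [:0, of_real a:] [:0, of_real a:] 1"

definition direct_sum_pmat :: "2 pmat" where
  "direct_sum_pmat = mat2 [:0, 1:] 0 0 1"

definition darboux_op :: "real \<Rightarrow> real \<Rightarrow> 2 pdop" where
  "darboux_op \<alpha> a = [:mat2 1 [:of_real (- a * (\<alpha> + 1)):] 0 1,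
     mat2 0 [:0, of_real (- a):] [:of_real (- a):] [:0, of_real (a\<^sup>2):]:]"

definition conjugate_op :: "real \<Rightarrow> real \<Rightarrow> 2 pdop" where
  "conjugate_op \<alpha> a = [:mat2 [:of_real (1 + a\<^sup>2):] [:of_real (a * (\<alpha> + 1)):] 0 1,
     mat2 [:0, of_real (a\<^sup>2):] [:0, of_real a:] [:of_real a:] 0:]"

definition laguerre_op :: "real \<Rightarrow> real \<Rightarrow> 2 pdop" where
  "laguerre_op \<alpha> a = [:mat2 [:of_real (1 + a\<^sup>2):] 0 0 1,
     mat2 [:of_real (- a\<^sup>2 * (\<alpha> + 2)), of_real (a\<^sup>2):] 0 0
          [:of_real (- a\<^sup>2 * (\<alpha> + 1)), of_real (a\<^sup>2):],
     mat2 [:0, of_real (- a\<^sup>2):] 0 0 [:0, of_real (- a\<^sup>2):]:]"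

lemma positive_definite_weight_pmat:
  assumes "x > 0"
  shows "positive_definite (eval_pmat (weight_pmat a) x)"
  unfolding positive_definite_def
proof (intro conjI allI impI)
  show "conj_transpose (eval_pmat (weight_pmat a) x) = eval_pmat (weight_pmat a) x"
    by (simp add: mat2_eq_iff conj_transpose_def eval_pmat_nth weight_pmat_def)
  fix v :: "complex^2" assume v: "v \<noteq> 0"
  define w where "w = of_real (a * x) * v $ 1 + v $ 2"
  have "(\<Sum>i\<in>UNIV. \<Sum>j\<in>UNIV. cnj (v $ i) * eval_pmat (weight_pmat a) x $ i $ j * v $ j)
      = of_real x * (v $ 1 * cnj (v $ 1)) + w * cnj w"
    by (simp add: sum_2 eval_pmat_nth weight_pmat_def w_def algebra_simps power2_eq_square)
  also have "\<dots> = of_real (x * (cmod (v $ 1))\<^sup>2 + (cmod w)\<^sup>2)"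
    by (simp only: complex_norm_square of_real_add of_real_mult)
  finally have "Re (\<Sum>i\<in>UNIV. \<Sum>j\<in>UNIV. cnj (v $ i) * eval_pmat (weight_pmat a) x $ i $ j * v $ j)
      = x * (cmod (v $ 1))\<^sup>2 + (cmod w)\<^sup>2"
    by (simp only: Re_complex_of_real)
  moreover have "x * (cmod (v $ 1))\<^sup>2 + (cmod w)\<^sup>2 > 0"
  proof (cases "v $ 1 = 0")
    case True
    with v have "v $ 2 \<noteq> 0" by (auto simp: vec_eq_iff forall_2)
    with True show ?thesis by (simp add: w_def)
  next
    case False
    then show ?thesis using assms by (intro add_pos_nonneg) auto
  qed
  ultimately show "Re (\<Sum>i\<in>UNIV. \<Sum>j\<in>UNIV. cnj (v $ i) * eval_pmat (weight_pmat a) x $ i $ j * v $ j) > 0"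
    by simp
qed

lemma direct_sum_pmat_eq: "direct_sum_pmat = weight_pmat 0"
  by (simp add: direct_sum_pmat_def weight_pmat_def mat2_eq_iff)

lemma pdop_apply_first_order: "pdop_apply P [:A, B:] = P ** A + map_matrix pderiv P ** B"
proof -
  have "map_matrix (pderiv ^^ 0) P = P" by (simp add: vec_eq_iff)
  then show ?thesis by (simp add: pdop_apply_le[of _ 1])
qed

lemma pdop_apply_second_order:
  "pdop_apply P [:A, B, C:] =
     P ** A + map_matrix pderiv P ** B + map_matrix (pderiv \<circ> pderiv) P ** C"
proof -
  have "map_matrix (pderiv ^^ 0) P = P" by (simp add: vec_eq_iff)
  then show ?thesis by (simp add: pdop_apply_le[of _ 2] numeral_2_eq_2 degree_pCons_eq_if)
qed

lemma degree_preserving_darboux_op: "degree_preserving (darboux_op \<alpha> a)"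
  unfolding degree_preserving_def
proof (intro allI degree_pmat_cong)
  fix P :: "2 pmat" and N
  let ?PV = "pdop_apply P (darboux_op \<alpha> a)"
  have c1: "coeff (?PV $ i $ 1) k = coeff (P $ i $ 1) k - of_real a * of_nat (Suc k) * coeff (P $ i $ 2) (Suc k)"
    for i k
    by (simp add: darboux_op_def pdop_apply_first_order matrix_mult_nth_2 coeff_pderiv algebra_simps)
  have c2: "coeff (?PV $ i $ 2) k = - of_real (a * (\<alpha> + 1 + real k)) * coeff (P $ i $ 1) k
      + of_real (1 + a\<^sup>2 * real k) * coeff (P $ i $ 2) k" for i k
    by (cases k) (simp_all add: darboux_op_def pdop_apply_first_order matrix_mult_nth_2 coeff_pderiv
        algebra_simps)
  have zero_iff: "coeff_pmat R k = 0 \<longleftrightarrow> (\<forall>i. coeff (R $ i $ 1) k = 0 \<and> coeff (R $ i $ 2) k = 0)"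
    for R :: "2 pmat" and k
    by (auto simp: coeff_pmat_def vec_eq_iff forall_2)
  show "(\<forall>k\<ge>N. coeff_pmat ?PV k = 0) \<longleftrightarrow> (\<forall>k\<ge>N. coeff_pmat P k = 0)"
  proof
    assume "\<forall>k\<ge>N. coeff_pmat P k = 0"
    then show "\<forall>k\<ge>N. coeff_pmat ?PV k = 0"
      unfolding zero_iff c1 c2 by simp
  next
    assume PV: "\<forall>k\<ge>N. coeff_pmat ?PV k = 0"
    obtain d where d: "\<And>i j. degree (P $ i $ j) \<le> d" using ex_degree_bound[of P] by blast
    have descend: "coeff_pmat P k = 0" if "k \<ge> N" and "coeff_pmat P (Suc k) = 0" for k
    proof -
      have "1 + a\<^sup>2 * real k > 0" by (intro add_pos_nonneg) auto
      then have "complex_of_real (1 + a\<^sup>2 * real k) \<noteq> 0"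
        unfolding of_real_eq_0_iff by simp
      moreover have 1: "coeff (P $ i $ 1) k = 0" for i
        using PV that unfolding zero_iff c1 by simp
      moreover have "complex_of_real (1 + a\<^sup>2 * real k) * coeff (P $ i $ 2) k = 0" for i
        using PV that(1) 1 unfolding zero_iff c2 by simp
      ultimately show ?thesis
        unfolding zero_iff mult_eq_0_iff by blast
    qed
    have top: "coeff_pmat P k = 0" if "k > d" for k
      using that d by (auto simp: coeff_pmat_def vec_eq_iff intro!: coeff_eq_0 le_less_trans[OF d])
    show "\<forall>k\<ge>N. coeff_pmat P k = 0"
    proof (intro allI impI)
      fix k assume k: "k \<ge> N"
      have "k \<le> k + Suc d" by simp
      then show "coeff_pmat P k = 0"
      proof (induction rule: inc_induct)
        case base
        show ?case by (rule top) simp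
      next
        case (step n)
        then show ?case using k descend by simp
      qed
    qed
  qed
qed

lemma det_lead_coeff_darboux_op: "a \<noteq> 0 \<Longrightarrow> det (lead_coeff (darboux_op \<alpha> a)) \<noteq> 0"
  by (auto simp: darboux_op_def det_2 mat2_eq_iff)

lemma laguerre_op_in_diff_op_algebra:
  assumes "\<alpha> > -1"
    and W: "\<And>x. x > 0 \<Longrightarrow> W x = laguerre_weight \<alpha> x *\<^sub>R eval_pmat direct_sum_pmat x"
  shows "laguerre_op \<alpha> a \<in> diff_op_algebra 0 \<infinity> W"
proof -
  define P where "P n = mat2 (laguerre_poly (\<alpha> + 1) n) 0 0 (laguerre_poly \<alpha> n)" for n
  have cnj: "map_poly cnj (laguerre_poly \<beta> n) = laguerre_poly \<beta> n" for \<beta> n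
    by (rule poly_eqI) (simp add: coeff_map_poly coeff_laguerre_poly)
  have "inner_W 0 \<infinity> W (eval_pmat (P n)) (eval_pmat (P m)) = 0" if "n \<noteq> m" for n m
  proof -
    have "laguerre_moment \<alpha> (pCons 0 (laguerre_poly (\<alpha> + 1) n * laguerre_poly (\<alpha> + 1) m)) = 0"
      using laguerre_poly_orthogonal[of "\<alpha> + 1", OF _ that] assms(1)
      by (simp add: laguerre_moment_shift)
    then show ?thesis
      using laguerre_poly_orthogonal[OF assms(1) that]
      by (simp add: inner_W_laguerre[OF assms(1) W] mat2_eq_iff matrix_mult_nth_2 P_def
          direct_sum_pmat_def adjoint_pmat_def cnj mult_pCons_left)
  qed
  moreover have "degree_pmat (P n) = ereal (real n)" and "coeff_pmat (P n) n = mat 1" for n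
  proof -
    show c: "coeff_pmat (P n) n = mat 1"
      by (simp add: P_def coeff_pmat_def mat2_eq_iff mat_def coeff_laguerre_poly)
    show "degree_pmat (P n) = ereal (real n)"
      by (rule degree_pmat_eqI)
        (simp_all only: c, auto simp: P_def coeff_pmat_def mat2_eq_iff mat_def coeff_laguerre_poly)
  qed
  ultimately have "monic_orthogonal_polys 0 \<infinity> W P"
    by (simp add: monic_orthogonal_polys_def)
  moreover have "pdop_apply (P n) (laguerre_op \<alpha> a) = map_matrix (\<lambda>c. [:c:])
      (mat2 (of_real (1 + a\<^sup>2 * (real n + 1))) 0 0 (of_real (1 + a\<^sup>2 * real n))) ** P n" for n
  proof -
    have *: "smult (of_real (- a\<^sup>2)) ([:0, 1:] * pderiv (pderiv (laguerre_poly \<beta> n))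
         + [:of_real (\<beta> + 1), -1:] * pderiv (laguerre_poly \<beta> n))
       = smult (of_real (- a\<^sup>2)) (smult (- of_nat n) (laguerre_poly \<beta> n))" for \<beta>
      unfolding laguerre_poly_ode ..
    show ?thesis
      using *[of "\<alpha> + 1"] *[of \<alpha>]
      by (simp add: laguerre_op_def pdop_apply_second_order mat2_eq_iff matrix_mult_nth_2 P_def
          algebra_simps smult_add_left smult_add_right smult_diff_left smult_diff_right)
  qed
  ultimately show ?thesis
    unfolding diff_op_algebra_def by blast
qed

lemma darboux_conjugate_eq:
  assumes W1: "\<And>x. x > 0 \<Longrightarrow> W1 x = laguerre_weight \<alpha> x *\<^sub>R eval_pmat direct_sum_pmat x"
    and W2: "\<And>x. x > 0 \<Longrightarrow> W2 x = laguerre_weight \<alpha> x *\<^sub>R eval_pmat (weight_pmat a) x"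
    and "a \<noteq> 0"
  shows "dop_eq_on {0<..} (darboux_conjugate W1 W2 (darboux_op \<alpha> a)) (dop_of_pdop (conjugate_op \<alpha> a))"
proof -
  let ?V = "dop_of_pdop (darboux_op \<alpha> a)"
  define F where "F = formal_adjoint ?V"
  define B where "B = adjoint_pmat (coeff (darboux_op \<alpha> a) 1)"
  have "eval_pmat (coeff (darboux_op \<alpha> a) 1) \<noteq> 0"
  proof
    assume "eval_pmat (coeff (darboux_op \<alpha> a) 1) = 0"
    then have "eval_pmat (coeff (darboux_op \<alpha> a) 1) 0 $ 2 $ 1 = 0" by simp
    then show False using assms(3) by (simp add: darboux_op_def eval_pmat_nth)
  qed
  moreover have "degree (darboux_op \<alpha> a) = 1"
    using assms(3) by (simp add: darboux_op_def mat2_eq_iff)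
  ultimately have deg: "degree ?V = 1"
    unfolding dop_of_pdop_def by (subst map_poly_degree_eq) simp_all
  have "(\<lambda>x. conj_transpose (coeff ?V 1 x)) = eval_pmat B"
    by (simp add: coeff_dop_of_pdop conj_transpose_eval_pmat B_def)
  then have F0: "coeff F 0 x = eval_pmat (adjoint_pmat (coeff (darboux_op \<alpha> a) 0)) x
      - eval_pmat (map_matrix pderiv B) x"
    and F1: "coeff F 1 x = - eval_pmat B x" and F: "degree F \<le> 1" for x
    using coeff_formal_adjoint_first_order(1,2)[OF deg, of x] coeff_formal_adjoint_first_order(3)[OF deg]
    by (simp_all add: F_def nth_deriv_eval_pmat coeff_dop_of_pdop conj_transpose_eval_pmat)
  define G where "G = dop_mult (mult_dop W2) F"
  have G: "degree G \<le> 1" unfolding G_def by (rule coeff_mult_dop_left(3)[OF F])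
  have I: "degree (mult_dop (\<lambda>x. matrix_inv (W1 x))) \<le> 1" by (simp add: degree_mult_dop)
  have N: "darboux_conjugate W1 W2 (darboux_op \<alpha> a) = dop_mult G (mult_dop (\<lambda>x. matrix_inv (W1 x)))"
    by (simp add: darboux_conjugate_def G_def F_def)
  have main: "coeff G 0 x = eval_pmat (coeff (conjugate_op \<alpha> a) 0) x ** W1 x"
      "coeff G 1 x = eval_pmat (coeff (conjugate_op \<alpha> a) 1) x ** W1 x"
      "W1 x ** matrix_inv (W1 x) = mat 1" if "x > 0" for x
  proof -
    have deriv: "vector_derivative W2 (at x) = laguerre_weight (\<alpha> - 1) x *\<^sub>R
      eval_pmat (map_matrix (\<lambda>p. [:0, 1:] * pderiv p + [:of_real \<alpha>, -1:] * p) (weight_pmat a)) x"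
      by (intro vector_derivative_at
        has_vector_derivative_transform_within_open[OF has_vector_derivative_laguerre_pmat[OF that]
          open_greaterThan[of 0]]) (use that W2 in auto)
    have w: "laguerre_weight \<alpha> x = x * laguerre_weight (\<alpha> - 1) x"
      using laguerre_weight_mult_power[OF that, of 1 "\<alpha> - 1"] by simp
    show "coeff G 0 x = eval_pmat (coeff (conjugate_op \<alpha> a) 0) x ** W1 x"
      "coeff G 1 x = eval_pmat (coeff (conjugate_op \<alpha> a) 1) x ** W1 x"
      unfolding G_def coeff_mult_dop_left(1,2)[OF F] F0 F1
      by (simp_all add: nth_deriv_Suc deriv w W1 W2 that mat2_eq_iff matrix_mult_nth_2 eval_pmat_nth
          B_def adjoint_pmat_def darboux_op_def conjugate_op_def weight_pmat_def direct_sum_pmat_def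
          map_poly_pCons pderiv_pCons scaleR_conv_of_real[where 'a = complex]
          power2_eq_square algebra_simps)
    define c where "c = complex_of_real (laguerre_weight \<alpha> x)"
    have c: "c \<noteq> 0" using laguerre_weight_pos[OF that, of \<alpha>] by (simp add: c_def)
    show "W1 x ** matrix_inv (W1 x) = mat 1"
      by (rule matrix_inv_right[where B = "mat2 (1 / (c * of_real x)) 0 0 (1 / c)"])
        (use c that in \<open>simp_all add: W1 mat2_eq_iff matrix_mult_nth_2 eval_pmat_nth mat_def
          direct_sum_pmat_def scaleR_conv_of_real[where 'a = complex] flip: c_def\<close>)
  qed
  show ?thesis
    unfolding dop_eq_on_def
  proof (intro allI ballI)
    fix i :: nat and x :: real assume "x \<in> {0<..}"
    then have x: "x > 0" by simp
    note c = coeff_dop_mult_first_order[OF G I, folded N, unfolded coeff_mult_dop, where x = x]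
    have inv: "A ** W1 x ** matrix_inv (W1 x) = A" for A :: "complex^2^2"
      by (simp add: main(3)[OF x] flip: matrix_mul_assoc)
    consider "i = 0" | "i = 1" | "i = 2" | "i > 2" by linarith
    then show "coeff (darboux_conjugate W1 W2 (darboux_op \<alpha> a)) i x
        = coeff (dop_of_pdop (conjugate_op \<alpha> a)) i x"
    proof cases
      case 1
      then show ?thesis using c(1) main(1)[OF x] inv by (simp add: coeff_dop_of_pdop)
    next
      case 2
      then show ?thesis using c(2) main(2)[OF x] inv by (simp add: coeff_dop_of_pdop)
    next
      case 3
      then show ?thesis using c(3) by (simp add: coeff_dop_of_pdop conjugate_op_def coeff_pCons numeral_2_eq_2)
    next
      case 4
      then show ?thesis using c(4) by (simp add: coeff_dop_of_pdop conjugate_op_def coeff_eq_0)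
    qed
  qed
qed

lemma degree_dop_of_pdop_le: "degree (dop_of_pdop D) \<le> degree D"
  by (simp add: dop_of_pdop_def map_poly_degree_leq)

lemma darboux_factorization:
  "dop_eq_on S (dop_of_pdop (laguerre_op \<alpha> a))
     (dop_mult (dop_of_pdop (darboux_op \<alpha> a)) (dop_of_pdop (conjugate_op \<alpha> a)))"
  unfolding dop_eq_on_def
proof (intro allI ballI)
  fix i :: nat and x
  have "degree (darboux_op \<alpha> a) \<le> 1" "degree (conjugate_op \<alpha> a) \<le> 1"
    by (simp_all add: darboux_op_def conjugate_op_def)
  then have d: "degree (dop_of_pdop (darboux_op \<alpha> a)) \<le> 1" "degree (dop_of_pdop (conjugate_op \<alpha> a)) \<le> 1"
    using degree_dop_of_pdop_le order_trans by blast+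
  note c = coeff_dop_mult_first_order[OF d, unfolded coeff_dop_of_pdop nth_deriv_eval_pmat, where x = x]
  consider "i = 0" | "i = 1" | "i = 2" | "i > 2" by linarith
  then show "coeff (dop_of_pdop (laguerre_op \<alpha> a)) i x =
    coeff (dop_mult (dop_of_pdop (darboux_op \<alpha> a)) (dop_of_pdop (conjugate_op \<alpha> a))) i x"
  proof cases
    case 1
    show ?thesis
      unfolding 1 c(1) coeff_dop_of_pdop
      by (simp add: mat2_eq_iff matrix_mult_nth_2 eval_pmat_nth darboux_op_def conjugate_op_def
          laguerre_op_def pderiv_pCons algebra_simps)
  next
    case 2
    show ?thesis
      unfolding 2 c(2) coeff_dop_of_pdop
      by (simp add: mat2_eq_iff matrix_mult_nth_2 eval_pmat_nth darboux_op_def conjugate_op_def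
          laguerre_op_def pderiv_pCons power2_eq_square algebra_simps)
  next
    case 3
    show ?thesis
      unfolding 3 c(3) coeff_dop_of_pdop
      by (simp add: mat2_eq_iff matrix_mult_nth_2 eval_pmat_nth darboux_op_def conjugate_op_def
          laguerre_op_def numeral_2_eq_2 power2_eq_square algebra_simps)
  next
    case 4
    then show ?thesis
      unfolding c(4)[OF 4] coeff_dop_of_pdop
      by (simp add: laguerre_op_def coeff_eq_0 degree_pCons_eq_if)
  qed
qed

text \<open>The two integrands differ by the derivative of \<open>x w h\<close>, where \<open>w\<close> is the scalar Laguerre weight.\<close>

lemma darboux_moment_adjoint:
  assumes "\<alpha> > -1"
  shows "map_matrix (laguerre_moment \<alpha>)
      (pdop_apply P (darboux_op \<alpha> a) ** weight_pmat a ** adjoint_pmat Q)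
    = map_matrix (laguerre_moment \<alpha>)
      (P ** direct_sum_pmat ** adjoint_pmat (pdop_apply Q (conjugate_op \<alpha> a)))"
    (is "map_matrix _ ?L = map_matrix _ ?R")
proof -
  have "laguerre_moment \<alpha> (?L $ i $ j) = laguerre_moment \<alpha> (?R $ i $ j)" for i j
  proof -
    define A C x where "A = [:complex_of_real a:]" and "C = [:complex_of_real \<alpha>:]"
      and "x = [:0, 1 :: complex:]"
    define p1 p2 q1 q2 where "p1 = P $ i $ 1" and "p2 = P $ i $ 2"
      and "q1 = map_poly cnj (Q $ j $ 1)" and "q2 = map_poly cnj (Q $ j $ 2)"
    define h where "h = - A * (p2 * q1 + A * x * p1 * q1 + p1 * q2)"
    have pA: "pderiv A = 0" "pderiv x = 1" by (simp_all add: A_def x_def pderiv_pCons)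
    have "?L $ i $ j = (p1 - A * pderiv p2) * ((x + A * A * x * x) * q1 + A * x * q2)
        + (p2 - A * (C + 1) * p1 - A * x * pderiv p1 + A * A * x * pderiv p2) * (A * x * q1 + q2)"
      by (simp add: matrix_mult_nth_2 pdop_apply_first_order darboux_op_def weight_pmat_def adjoint_pmat_def
          A_def C_def x_def p1_def p2_def q1_def q2_def power2_eq_square algebra_simps
          smult_add_left smult_add_right smult_diff_left smult_diff_right)
    moreover have "?R $ i $ j = p1 * x * ((1 + A * A) * q1 + A * A * x * pderiv q1 + A * pderiv q2)
        + p2 * (A * (C + 1) * q1 + A * x * pderiv q1 + q2)"
      by (simp add: matrix_mult_nth_2 pdop_apply_first_order conjugate_op_def direct_sum_pmat_def adjoint_pmat_def
          A_def C_def x_def p1_def p2_def q1_def q2_def power2_eq_square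
          map_poly_cnj_add map_poly_cnj_mult map_poly_cnj_pderiv map_poly_pCons algebra_simps
          smult_add_left smult_add_right smult_diff_left smult_diff_right)
    moreover have "[:0, 1:] * pderiv h + [:of_real (\<alpha> + 1), -1:] * h = x * pderiv h + (C + 1 - x) * h"
      by (simp add: x_def C_def one_pCons)
    moreover have "pderiv h = - A * (pderiv p2 * q1 + p2 * pderiv q1 + A * p1 * q1 + A * x * pderiv p1 * q1
        + A * x * p1 * pderiv q1 + pderiv p1 * q2 + p1 * pderiv q2)"
      by (simp add: h_def pderiv_mult pderiv_add pderiv_minus pA) algebra
    ultimately have "?L $ i $ j = ?R $ i $ j + ([:0, 1:] * pderiv h + [:of_real (\<alpha> + 1), -1:] * h)"
      unfolding h_def by algebra
    then show ?thesis
      by (simp only: laguerre_moment_add[of _ "?R $ i $ j"] laguerre_moment_by_parts[OF assms] add_0_right)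
  qed
  then show ?thesis by (simp add: vec_eq_iff)
qed

theorem proposition4p1:
  fixes \<alpha> a :: real
  assumes "\<alpha> > -1" and "a \<noteq> 0"
  defines "W \<equiv> (\<lambda>x :: real. (exp (- x) * x powr \<alpha>) *\<^sub>R
             (vector [vector [of_real (x * (1 + a\<^sup>2 * x)), of_real (a * x)],
                      vector [of_real (a * x),              1]] :: complex^2^2))"
    and "Wt \<equiv> (\<lambda>x :: real.
             (vector [vector [of_real (exp (- x) * x powr (\<alpha> + 1)), 0],
                      vector [0, of_real (exp (- x) * x powr \<alpha>)]] :: complex^2^2))"
  shows "strong_darboux_transformation 0 \<infinity> Wt W"
proof -
  have W: "W x = laguerre_weight \<alpha> x *\<^sub>R eval_pmat (weight_pmat a) x" if "x > 0" for x
    by (simp add: W_def laguerre_weight_def mat2_eq_iff eval_pmat_nth weight_pmat_def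
        power2_eq_square algebra_simps)
  have Wt: "Wt x = laguerre_weight \<alpha> x *\<^sub>R eval_pmat direct_sum_pmat x" if "x > 0" for x
    using that
    by (simp add: Wt_def laguerre_weight_def mat2_eq_iff eval_pmat_nth direct_sum_pmat_def
        powr_add scaleR_conv_of_real[where 'a = complex])
  note conj = darboux_conjugate_eq[where ?W1.0 = Wt and ?W2.0 = W, OF Wt W assms(2)]
  have "weight_matrix 0 \<infinity> Wt" "weight_matrix 0 \<infinity> W"
    using weight_matrix_laguerre[OF assms(1) Wt positive_definite_weight_pmat[where a = 0, folded direct_sum_pmat_eq]]
      weight_matrix_laguerre[OF assms(1) W positive_definite_weight_pmat] by blast+
  moreover have "dop_eq_on (einterval 0 \<infinity>) (dop_of_pdop (laguerre_op \<alpha> a))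
      (dop_mult (dop_of_pdop (darboux_op \<alpha> a)) (darboux_conjugate Wt W (darboux_op \<alpha> a)))"
    using darboux_factorization[of "{0<..}" \<alpha> a] dop_mult_cong_right[OF conj]
    by (simp add: dop_eq_on_def einterval_0_infinity)
  moreover have "inner_W 0 \<infinity> W (eval_pmat (pdop_apply P (darboux_op \<alpha> a))) (eval_pmat Q) =
      inner_W 0 \<infinity> Wt (eval_pmat P) (dop_apply (eval_pmat Q) (darboux_conjugate Wt W (darboux_op \<alpha> a)))"
    for P Q
    using inner_W_laguerre[OF assms(1) W refl refl]
      inner_W_laguerre[OF assms(1) Wt refl dop_apply_pdop[OF conj]]
      darboux_moment_adjoint[OF assms(1)] by simp
  ultimately show ?thesis
    unfolding strong_darboux_transformation_def
    using degree_preserving_darboux_op det_lead_coeff_darboux_op[OF assms(2)]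
      laguerre_op_in_diff_op_algebra[OF assms(1) Wt]
    by blast
qed

end
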